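(* Let $\mathcal{C}=\mathcal{L}\mathcal{M}$ be a CMV matrix. For any band matrix $\Omega$ and any integer $n\ge0$: (i) $\big((\mathrm{ad}_n\,\mathcal{C})\Omega\big)^t=(-1)^n(\mathrm{ad}_n\,\mathcal{C}^t)\Omega^t$. (ii) $(\mathrm{ad}_n\,\mathcal{C})(\mathcal{L}\Omega\mathcal{M})=\mathcal{L}\big((\mathrm{ad}_n\,\mathcal{C}^t)\Omega\big)\mathcal{M}$ if $n$ is even, and $(\mathrm{ad}_n\,\mathcal{C})(\mathcal{L}\Omega\mathcal{M})=\mathcal{M}\big((\mathrm{ad}_n\,\mathcal{C}^t)\Omega\big)\mathcal{L}$ if $n$ is odd. (iii) For every integer $k$ with $0\le k\le n$, $(\mathrm{ad}_n\,\mathcal{C})\Omega=(\mathrm{ad}_{n-k}\,\mathcal{C}(k))\big((\mathrm{ad}_k\,\mathcal{C})\Omega\big)$, where $\mathcal{C}(k):=\mathcal{C}$ for even $k$ and $\mathcal{C}(k):=\mathcal{C}^t$ for odd $k$.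
   Context: All matrices are complex and infinite, with rows and columns indexed by $0,1,2,\dots$; $A^\dagger$ is the conjugate transpose and $A^t$ the transpose. A band matrix is one with only finitely many nonzero diagonals. Given a sequence $(\alpha_n)_{n\ge0}$ (the Verblunsky coefficients) in the open unit disk, put $\rho_n=\sqrt{1-|\alpha_n|^2}$, $\Theta_n=\begin{pmatrix}\overline{\alpha}_n&\rho_n\\ \rho_n&-\alpha_n\end{pmatrix}$, $\mathcal{L}=\Theta_0\oplus\Theta_2\oplus\Theta_4\oplus\cdots$, $\mathcal{M}=(1)\oplus\Theta_1\oplus\Theta_3\oplus\cdots$. The CMV matrix is $\mathcal{C}=\mathcal{L}\mathcal{M}$ (a five-diagonal unitary matrix; $\mathcal{L},\mathcal{M}$ are symmetric and unitary), and $\mathcal{C}^t=\mathcal{M}\mathcal{L}$. For a band matrix $\Omega$, $(\mathrm{ad}\,\mathcal{C})\Omega=\mathcal{C}\Omega-\Omega\mathcal{C}$, $(\mathrm{ad}\,\mathcal{C})^n$ is its $n$-th iterate, and $$(\mathrm{ad}_n\,\mathcal{C})\Omega:=\begin{cases}(\mathcal{C}^\dagger)^m\,\big((\mathrm{ad}\,\mathcal{C})^n\Omega\big)\,(\mathcal{C}^\dagger)^m,& n=2m,\\ \mathcal{L}^\dagger(\mathcal{C}^\dagger)^m\,\big((\mathrm{ad}\,\mathcal{C})^n\Omega\big)\,(\mathcal{C}^\dagger)^m\mathcal{M}^\dagger,& n=2m+1.\end{cases}$$ The operator $(\mathrm{ad}_n\,\mathcal{C}^t)$ is defined in the same way after the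 exchanges $\mathcal{C}\leftrightarrow\mathcal{C}^t$, $\mathcal{L}\leftrightarrow\mathcal{M}$: with $(\mathrm{ad}\,\mathcal{C}^t)\Omega=\mathcal{C}^t\Omega-\Omega\mathcal{C}^t$, $$(\mathrm{ad}_n\,\mathcal{C}^t)\Omega:=\begin{cases}((\mathcal{C}^t)^\dagger)^m\,\big((\mathrm{ad}\,\mathcal{C}^t)^n\Omega\big)\,((\mathcal{C}^t)^\dagger)^m,& n=2m,\\ \mathcal{M}^\dagger((\mathcal{C}^t)^\dagger)^m\,\big((\mathrm{ad}\,\mathcal{C}^t)^n\Omega\big)\,((\mathcal{C}^t)^\dagger)^m\mathcal{L}^\dagger,& n=2m+1.\end{cases}$$ *)

theory Defs
  imports Complex_Main
begin

type_synonym inf_mat = "nat \<Rightarrow> nat \<Rightarrow> complex"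

text \<open>A matrix is a band matrix if only finitely many of its diagonals \<open>j - i = d\<close> are nonzero.\<close>
definition band :: "inf_mat \<Rightarrow> bool" where
  "band A \<longleftrightarrow> finite {int j - int i | i j. A i j \<noteq> 0}"

text \<open>The series defining an entry of a product has only finitely many nonzero terms if one of
  the factors is a band matrix; every product formed below starting from band matrices is of
  this kind.\<close>
definition mmult :: "inf_mat \<Rightarrow> inf_mat \<Rightarrow> inf_mat" (infixl "\<star>" 70) where
  "A \<star> B = (\<lambda>i j. \<Sum>k. A i k * B k j)"

definition msub :: "inf_mat \<Rightarrow> inf_mat \<Rightarrow> inf_mat" where
  "msub A B = (\<lambda>i j. A i j - B i j)"

definition mscale :: "complex \<Rightarrow> inf_mat \<Rightarrow> inf_mat" where
  "mscale c A = (\<lambda>i j. c * A i j)"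

definition mone :: inf_mat where
  "mone = (\<lambda>i j. if i = j then 1 else 0)"

primrec mpow :: "inf_mat \<Rightarrow> nat \<Rightarrow> inf_mat" where
  "mpow A 0 = mone"
| "mpow A (Suc m) = A \<star> mpow A m"

definition mtrans :: "inf_mat \<Rightarrow> inf_mat" where
  "mtrans A = (\<lambda>i j. A j i)"

definition madj :: "inf_mat \<Rightarrow> inf_mat" where
  "madj A = (\<lambda>i j. cnj (A j i))"

definition rho :: "(nat \<Rightarrow> complex) \<Rightarrow> nat \<Rightarrow> real" where
  "rho \<alpha> n = sqrt (1 - (cmod (\<alpha> n))\<^sup>2)"

text \<open>A \<open>2 \<times> 2\<close> block is a function of a row and a column index in \<open>{0, 1}\<close>; its values at
  other indices are irrelevant.\<close>
definition Theta :: "(nat \<Rightarrow> complex) \<Rightarrow> nat \<Rightarrow> nat \<Rightarrow> nat \<Rightarrow> complex" where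
  "Theta \<alpha> n r s =
     (if r = 0 \<and> s = 0 then cnj (\<alpha> n)
      else if r = 1 \<and> s = 1 then - \<alpha> n
      else complex_of_real (rho \<alpha> n))"

text \<open>\<open>B 0 \<oplus> B 1 \<oplus> B 2 \<oplus> \<dots>\<close> for \<open>2 \<times> 2\<close> blocks: block \<open>p\<close> occupies the indices \<open>2 p\<close>
  and \<open>2 p + 1\<close>.\<close>
definition block_diag2 :: "(nat \<Rightarrow> nat \<Rightarrow> nat \<Rightarrow> complex) \<Rightarrow> inf_mat" where
  "block_diag2 B = (\<lambda>i j. if i div 2 = j div 2 then B (i div 2) (i mod 2) (j mod 2) else 0)"

text \<open>\<open>(1) \<oplus> A\<close>.\<close>
definition one_oplus :: "inf_mat \<Rightarrow> inf_mat" where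
  "one_oplus A = (\<lambda>i j. case (i, j) of
      (0, 0) \<Rightarrow> 1
    | (Suc i', Suc j') \<Rightarrow> A i' j'
    | _ \<Rightarrow> 0)"

definition Lfac :: "(nat \<Rightarrow> complex) \<Rightarrow> inf_mat" where
  "Lfac \<alpha> = block_diag2 (\<lambda>p. Theta \<alpha> (2 * p))"

definition Mfac :: "(nat \<Rightarrow> complex) \<Rightarrow> inf_mat" where
  "Mfac \<alpha> = one_oplus (block_diag2 (\<lambda>p. Theta \<alpha> (2 * p + 1)))"

definition cmv :: "(nat \<Rightarrow> complex) \<Rightarrow> inf_mat" where
  "cmv \<alpha> = Lfac \<alpha> \<star> Mfac \<alpha>"

definition ad :: "inf_mat \<Rightarrow> inf_mat \<Rightarrow> inf_mat" where
  "ad C \<Omega> = msub (C \<star> \<Omega>) (\<Omega> \<star> C)"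

text \<open>The common shape of \<open>ad\<^sub>n C\<close> and \<open>ad\<^sub>n C\<^sup>t\<close>, where \<open>m = n div 2\<close>; the exchange
  of \<open>C\<close> with \<open>C\<^sup>t\<close> and of \<open>L\<close> with \<open>M\<close> is an exchange of arguments.\<close>
definition ad_shape :: "inf_mat \<Rightarrow> inf_mat \<Rightarrow> inf_mat \<Rightarrow> nat \<Rightarrow> inf_mat \<Rightarrow> inf_mat" where
  "ad_shape C L M n \<Omega> =
     (let m = n div 2; P = mpow (madj C) m; X = (ad C ^^ n) \<Omega> in
      if even n then P \<star> X \<star> P
      else madj L \<star> P \<star> X \<star> P \<star> madj M)"

definition ad_C :: "(nat \<Rightarrow> complex) \<Rightarrow> nat \<Rightarrow> inf_mat \<Rightarrow> inf_mat" where
  "ad_C \<alpha> = ad_shape (cmv \<alpha>) (Lfac \<alpha>) (Mfac \<alpha>)"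

definition ad_Ct :: "(nat \<Rightarrow> complex) \<Rightarrow> nat \<Rightarrow> inf_mat \<Rightarrow> inf_mat" where
  "ad_Ct \<alpha> = ad_shape (mtrans (cmv \<alpha>)) (Mfac \<alpha>) (Lfac \<alpha>)"

end

theory Submission imports Defs begin

text \<open>Let \<open>L\<close> and \<open>M\<close> be the unitary factors of \<open>C = L M\<close>. The powers of \<open>C\<^sup>\<dagger>\<close> around
  \<open>(ad C)\<^sup>n \<Omega>\<close>, and the extra \<open>L\<^sup>\<dagger>\<close> and \<open>M\<^sup>\<dagger>\<close> for odd \<open>n\<close>, are chosen so that they
  absorb every factor \<open>C\<close> that the commutators produce: passing from \<open>ad\<^sub>n C\<close> to \<open>ad\<^sub>n\<^sub>+\<^sub>1 C\<close> applies
  \<open>X \<mapsto> M X M\<^sup>\<dagger> - L\<^sup>\<dagger> X L\<close> if \<open>n\<close> is even and \<open>X \<mapsto> L X L\<^sup>\<dagger> - M\<^sup>\<dagger> X M\<close> if \<open>n\<close> is odd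
  (lemma \<open>ad_shape_eq_alt_cross\<close>). These two maps, \<open>cross L M\<close> and \<open>cross M L\<close>, are
  interchanged by exchanging \<open>L\<close> with \<open>M\<close>, so \<open>ad\<^sub>n C\<^sup>t\<close> is the same alternating composition
  started with the other map.

  The three claims are then properties of alternating compositions. Splitting the composition
  after \<open>k\<close> steps gives (iii) (lemma \<open>alt_cross_add\<close>). Since \<open>L\<close> and \<open>M\<close> are symmetric,
  \<open>(cross L M X)\<^sup>t = - cross M L X\<^sup>t\<close>; iterating gives (i) (lemma \<open>btrans_alt_cross\<close>). Since
  they are unitary, \<open>cross L M (L X M) = M (cross M L X) L\<close>; every step exchanges the outer
  factors, which is the case distinction in (ii) (lemma \<open>alt_cross_sandwich\<close>).

  All this is calculation in a noncommutative ring. Products of infinite matrices are not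
  associative in general, but they are for band matrices, where every entry of a product is a
  finite sum. The band matrices are therefore made into a type of class \<^class>\<open>ring_1\<close>.\<close>

section \<open>Products of band matrices\<close>

text \<open>A common bound on the distance from the diagonal, in place of the finite set of nonzero
  diagonals: bandwidths add under multiplication, and they bound the range of summation.\<close>
lemma band_iff_bandwidth:
  "band A \<longleftrightarrow> (\<exists>N. \<forall>i j. A i j \<noteq> 0 \<longrightarrow> i \<le> j + N \<and> j \<le> i + N)" (is "_ \<longleftrightarrow> ?R")
proof
  assume "band A"
  define D where "D = {int j - int i | i j. A i j \<noteq> 0}"
  define N where "N = Max (abs ` D)"
  have "finite D" using \<open>band A\<close> by (simp add: D_def band_def)
  then have N: "\<bar>d\<bar> \<le> N" if "d \<in> D" for d
    using that by (simp add: N_def)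
  have "i \<le> j + nat N \<and> j \<le> i + nat N" if "A i j \<noteq> 0" for i j
    using N[of "int j - int i"] that unfolding D_def by fastforce
  then show ?R by blast
next
  assume ?R
  then obtain N where "\<And>i j. A i j \<noteq> 0 \<Longrightarrow> i \<le> j + N \<and> j \<le> i + N" by blast
  then have "{int j - int i | i j. A i j \<noteq> 0} \<subseteq> {- int N..int N}" by fastforce
  then show "band A" unfolding band_def by (rule finite_subset) simp
qed

lemma mmult_eq_sum:
  assumes "finite K" "\<And>k. k \<notin> K \<Longrightarrow> A i k * B k j = 0"
  shows "(A \<star> B) i j = (\<Sum>k\<in>K. A i k * B k j)"
  unfolding mmult_def using assms by (intro suminf_finite) auto

lemma mmult_eq_sum_lessThan:
  assumes "\<And>k. A i k \<noteq> 0 \<Longrightarrow> B k j \<noteq> 0 \<Longrightarrow> k < K"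
  shows "(A \<star> B) i j = (\<Sum>k<K. A i k * B k j)"
  by (rule mmult_eq_sum) (use assms in auto)

lemma mmult_nonzeroD:
  assumes "(A \<star> B) i j \<noteq> 0"
  shows "\<exists>k. A i k \<noteq> 0 \<and> B k j \<noteq> 0"
proof (rule ccontr)
  assume "\<nexists>k. A i k \<noteq> 0 \<and> B k j \<noteq> 0"
  then have "(\<lambda>k. A i k * B k j) = (\<lambda>k. 0)" by auto
  then show False using assms by (simp add: mmult_def)
qed

lemma band_mmult:
  assumes "band A" "band B"
  shows "band (A \<star> B)"
proof -
  obtain N where N: "\<And>i j. A i j \<noteq> 0 \<Longrightarrow> i \<le> j + N \<and> j \<le> i + N"
    using assms(1) unfolding band_iff_bandwidth by blast
  obtain N' where N': "\<And>i j. B i j \<noteq> 0 \<Longrightarrow> i \<le> j + N' \<and> j \<le> i + N'"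
    using assms(2) unfolding band_iff_bandwidth by blast
  have "i \<le> j + (N + N') \<and> j \<le> i + (N + N')" if "(A \<star> B) i j \<noteq> 0" for i j
    using mmult_nonzeroD[OF that] N N' by fastforce
  then show ?thesis unfolding band_iff_bandwidth by blast
qed

lemma band_msub:
  assumes "band A" "band B"
  shows "band (msub A B)"
proof -
  have "A i j \<noteq> 0 \<or> B i j \<noteq> 0" if "msub A B i j \<noteq> 0" for i j
    using that by (auto simp: msub_def)
  then have "{int j - int i | i j. msub A B i j \<noteq> 0}
      \<subseteq> {int j - int i | i j. A i j \<noteq> 0} \<union> {int j - int i | i j. B i j \<noteq> 0}"
    by blast
  then show ?thesis using assms unfolding band_def by (auto intro: finite_subset)
qed

lemma band_mone: "band mone"
  unfolding band_iff_bandwidth mone_def by auto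

lemma band_mtrans: "band A \<Longrightarrow> band (mtrans A)"
  unfolding band_iff_bandwidth mtrans_def by blast

lemma band_madj: "band A \<Longrightarrow> band (madj A)"
  unfolding band_iff_bandwidth madj_def by auto

text \<open>With both bandwidths fixed, the two iterated series reduce to finite sums over a common
  square of indices, where they may be interchanged.\<close>
lemma mmult_assoc:
  assumes "band A" "band B"
  shows "A \<star> B \<star> C = A \<star> (B \<star> C)"
proof (intro ext)
  fix i j
  obtain N where N: "\<And>i j. A i j \<noteq> 0 \<Longrightarrow> i \<le> j + N \<and> j \<le> i + N"
    using assms(1) unfolding band_iff_bandwidth by blast
  obtain N' where N': "\<And>i j. B i j \<noteq> 0 \<Longrightarrow> i \<le> j + N' \<and> j \<le> i + N'"
    using assms(2) unfolding band_iff_bandwidth by blast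
  \<comment> \<open>Every index reached from \<open>i\<close> by a nonzero entry of \<open>A\<close>, followed or not by one of \<open>B\<close>,
      is below \<open>K\<close>.\<close>
  define K where "K = Suc (i + N + N')"
  have AB: "(A \<star> B) i k = (\<Sum>l<K. A i l * B l k)" for k
    by (rule mmult_eq_sum_lessThan) (use N[of i] in \<open>fastforce simp: K_def\<close>)
  have BC: "A i l * (B \<star> C) l j = A i l * (\<Sum>k<K. B l k * C k j)" for l
  proof (cases "A i l = 0")
    case False
    then have "l \<le> i + N" using N by blast
    then have "(B \<star> C) l j = (\<Sum>k<K. B l k * C k j)"
      by (intro mmult_eq_sum_lessThan) (use N'[of l] in \<open>fastforce simp: K_def\<close>)
    then show ?thesis by simp
  qed simp
  have "(A \<star> B \<star> C) i j = (\<Sum>k<K. (A \<star> B) i k * C k j)"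
  proof (rule mmult_eq_sum_lessThan)
    fix k assume "(A \<star> B) i k \<noteq> 0"
    from mmult_nonzeroD[OF this] obtain l where "A i l \<noteq> 0" "B l k \<noteq> 0" by blast
    then show "k < K" using N[of i l] N'[of l k] unfolding K_def by linarith
  qed
  also have "\<dots> = (\<Sum>k<K. \<Sum>l<K. A i l * (B l k * C k j))"
    by (simp add: AB sum_distrib_right mult.assoc)
  also have "\<dots> = (\<Sum>l<K. A i l * (B \<star> C) l j)"
    by (subst sum.swap) (simp add: BC sum_distrib_left)
  also have "\<dots> = (A \<star> (B \<star> C)) i j"
    by (rule mmult_eq_sum_lessThan[symmetric]) (use N[of i] in \<open>fastforce simp: K_def\<close>)
  finally show "(A \<star> B \<star> C) i j = (A \<star> (B \<star> C)) i j" .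
qed

lemma mmult_mone_left: "mone \<star> A = A"
proof (intro ext)
  fix i j
  have "(mone \<star> A) i j = (\<Sum>k\<in>{i}. mone i k * A k j)"
    by (rule mmult_eq_sum) (auto simp: mone_def)
  then show "(mone \<star> A) i j = A i j" by (simp add: mone_def)
qed

lemma mmult_mone_right: "A \<star> mone = A"
proof (intro ext)
  fix i j
  have "(A \<star> mone) i j = (\<Sum>k\<in>{j}. A i k * mone k j)"
    by (rule mmult_eq_sum) (auto simp: mone_def)
  then show "(A \<star> mone) i j = A i j" by (simp add: mone_def)
qed

lemma mtrans_mmult: "mtrans (A \<star> B) = mtrans B \<star> mtrans A"
  by (simp add: mtrans_def mmult_def mult.commute)

section \<open>The ring of band matrices\<close>

typedef bandmat = "{A. band A}"
  morphisms entries Bandmat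
  using band_mone by blast

setup_lifting type_definition_bandmat

instantiation bandmat :: ring_1
begin

lift_definition zero_bandmat :: bandmat is "\<lambda>i j. 0"
  by (simp add: band_def)

lift_definition one_bandmat :: bandmat is mone
  by (rule band_mone)

lift_definition times_bandmat :: "bandmat \<Rightarrow> bandmat \<Rightarrow> bandmat" is mmult
  by (rule band_mmult)

lift_definition minus_bandmat :: "bandmat \<Rightarrow> bandmat \<Rightarrow> bandmat" is msub
  by (rule band_msub)

lift_definition uminus_bandmat :: "bandmat \<Rightarrow> bandmat" is "\<lambda>A i j. - A i j"
  by (simp add: band_def)

lift_definition plus_bandmat :: "bandmat \<Rightarrow> bandmat \<Rightarrow> bandmat" is "\<lambda>A B i j. A i j + B i j"
  subgoal for A B using band_msub[of A "\<lambda>i j. - B i j"] by (simp add: band_def msub_def)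
  done

instance
proof
  fix a b c :: bandmat
  show "a * b * c = a * (b * c)" by transfer (rule mmult_assoc)
  show "1 * a = a" by transfer (rule mmult_mone_left)
  show "a * 1 = a" by transfer (rule mmult_mone_right)
  show "a + b + c = a + (b + c)" by transfer (simp add: add.assoc)
  show "a + b = b + a" by transfer (simp add: add.commute)
  show "0 + a = a" by transfer simp
  show "- a + a = 0" by transfer simp
  show "a - b = a + - b" by transfer (simp add: msub_def)
  show "(0 :: bandmat) \<noteq> 1" by transfer (metis mone_def zero_neq_one)
  show "(a + b) * c = a * c + b * c"
  proof transfer
    fix A B C assume b: "band A" "band B" "band C"
    show "(\<lambda>i j. A i j + B i j) \<star> C = (\<lambda>i j. (A \<star> C) i j + (B \<star> C) i j)"
    proof (intro ext)
      fix i j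
      obtain N where N: "\<And>k. C k j \<noteq> 0 \<Longrightarrow> k \<le> j + N"
        using b unfolding band_iff_bandwidth by meson
      have "(X \<star> C) i j = (\<Sum>k<Suc (j + N). X i k * C k j)" for X
        by (rule mmult_eq_sum_lessThan) (use N in fastforce)
      then show "((\<lambda>i j. A i j + B i j) \<star> C) i j = (A \<star> C) i j + (B \<star> C) i j"
        by (simp only: sum.distrib distrib_right)
    qed
  qed
  show "a * (b + c) = a * b + a * c"
  proof transfer
    fix A B C assume b: "band A" "band B" "band C"
    show "A \<star> (\<lambda>i j. B i j + C i j) = (\<lambda>i j. (A \<star> B) i j + (A \<star> C) i j)"
    proof (intro ext)
      fix i j
      obtain N where N: "\<And>k. A i k \<noteq> 0 \<Longrightarrow> k \<le> i + N"
        using b unfolding band_iff_bandwidth by meson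
      have "(A \<star> X) i j = (\<Sum>k<Suc (i + N). A i k * X k j)" for X
        by (rule mmult_eq_sum_lessThan) (use N in fastforce)
      then show "(A \<star> (\<lambda>i j. B i j + C i j)) i j = (A \<star> B) i j + (A \<star> C) i j"
        by (simp only: sum.distrib distrib_left)
    qed
  qed
qed

end

lift_definition btrans :: "bandmat \<Rightarrow> bandmat" is mtrans
  by (rule band_mtrans)

lift_definition badj :: "bandmat \<Rightarrow> bandmat" is madj
  by (rule band_madj)

lemma btrans_times: "btrans (a * b) = btrans b * btrans a"
  by transfer (rule mtrans_mmult)

lemma btrans_minus: "btrans (a - b) = btrans a - btrans b"
  by transfer (simp add: mtrans_def msub_def)

lemma btrans_uminus: "btrans (- a) = - btrans a"
  by transfer (simp add: mtrans_def)

lemma btrans_one [simp]: "btrans 1 = 1"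
  by transfer (auto simp: mtrans_def mone_def fun_eq_iff)

lemma btrans_badj: "btrans (badj a) = badj (btrans a)"
  by transfer (simp add: mtrans_def madj_def)

lemma badj_times: "badj (a * b) = badj b * badj a"
proof transfer
  fix A B assume b: "band A" "band B"
  show "madj (A \<star> B) = madj B \<star> madj A"
  proof (intro ext)
    fix i j
    obtain N where N: "\<And>k. A j k \<noteq> 0 \<Longrightarrow> k \<le> j + N"
      using b unfolding band_iff_bandwidth by meson
    have "(A \<star> B) j i = (\<Sum>k<Suc (j + N). A j k * B k i)"
      by (rule mmult_eq_sum_lessThan) (use N in fastforce)
    moreover have "(madj B \<star> madj A) i j = (\<Sum>k<Suc (j + N). madj B i k * madj A k j)"
      by (rule mmult_eq_sum_lessThan) (use N in \<open>fastforce simp: madj_def\<close>)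
    ultimately show "madj (A \<star> B) i j = (madj B \<star> madj A) i j"
      by (simp add: madj_def mult.commute)
  qed
qed

lemma entries_power: "entries (a ^ n) = mpow (entries a) n"
  by (induction n) (simp_all add: one_bandmat.rep_eq times_bandmat.rep_eq)

lemma entries_ad_iterate:
  "(ad (entries c) ^^ n) (entries x) = entries (((\<lambda>y. c * y - y * c) ^^ n) x)"
  by (induction n) (simp_all add: ad_def times_bandmat.rep_eq minus_bandmat.rep_eq)

lemma mscale_sign_entries: "mscale ((- 1) ^ n) (entries a) = entries ((- 1) ^ n * a)"
  by (cases "even n") (simp_all add: mscale_def uminus_bandmat.rep_eq)

section \<open>Iterated commutators with a product of two unitaries\<close>

definition unitary :: "bandmat \<Rightarrow> bool" where
  "unitary u \<longleftrightarrow> u * badj u = 1 \<and> badj u * u = 1"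

text \<open>One step of the normalized iteration. For unitary \<open>l\<close>, \<open>m\<close> and \<open>c = l m\<close>, the map
  \<open>cross l m\<close> sends \<open>x\<close> to \<open>l\<^sup>\<dagger> (c x - x c) m\<^sup>\<dagger>\<close>, the step from even to odd order, and
  \<open>cross m l\<close> sends \<open>x\<close> to \<open>c\<^sup>\<dagger> (c y - y c) c\<^sup>\<dagger>\<close> with \<open>y = l x m\<close>, the step from odd to even
  order.\<close>
definition cross :: "bandmat \<Rightarrow> bandmat \<Rightarrow> bandmat \<Rightarrow> bandmat" where
  "cross l m x = m * x * badj m - badj l * x * l"

text \<open>The recursion peels off the innermost map, so the factors exchange roles in the recursive
  call and no parity occurs in the definition.\<close>
primrec alt_cross :: "bandmat \<Rightarrow> bandmat \<Rightarrow> nat \<Rightarrow> bandmat \<Rightarrow> bandmat" where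
  "alt_cross l m 0 x = x"
| "alt_cross l m (Suc n) x = alt_cross m l n (cross l m x)"

lemma unitaryD:
  assumes "unitary u"
  shows "u * badj u = 1" "badj u * u = 1" "u * (badj u * y) = y" "badj u * (u * y) = y"
  using assms by (simp_all add: unitary_def flip: mult.assoc)

text \<open>After an odd number of steps the remaining composition starts with the other map.\<close>
lemma alt_cross_add:
  "alt_cross l m (k + j) x
     = (if even k then alt_cross l m j (alt_cross l m k x) else alt_cross m l j (alt_cross l m k x))"
  by (induction k arbitrary: l m x) auto

lemma alt_cross_Suc_outer:
  "alt_cross l m (Suc n) x
     = (if even n then cross l m (alt_cross l m n x) else cross m l (alt_cross l m n x))"
  using alt_cross_add[of l m n 1 x] by simp

text \<open>Transposition reverses products, fixes \<open>l\<close> and \<open>m\<close>, and therefore also fixes their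
  adjoints: the term with \<open>m\<close> on the left turns into one with \<open>m\<close> on the right, so the minuend
  and the subtrahend trade places.\<close>
lemma btrans_cross:
  assumes "btrans l = l" "btrans m = m"
  shows "btrans (cross l m x) = - cross m l (btrans x)"
  by (simp add: cross_def btrans_minus btrans_times btrans_badj assms mult.assoc)

lemma cross_uminus: "cross l m (- x) = - cross l m x"
  by (simp add: cross_def)

lemma alt_cross_uminus: "alt_cross l m n (- x) = - alt_cross l m n x"
  by (induction n arbitrary: l m x) (simp_all add: cross_uminus)

lemma btrans_alt_cross:
  assumes "btrans l = l" "btrans m = m"
  shows "btrans (alt_cross l m n x) = (- 1) ^ n * alt_cross m l n (btrans x)"
  using assms
  by (induction n arbitrary: l m x) (simp_all add: btrans_cross alt_cross_uminus)

text \<open>Both sides equal \<open>m l x - x m l\<close> once \<open>m m\<^sup>\<dagger>\<close> and \<open>l\<^sup>\<dagger> l\<close> are cancelled.\<close>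
lemma cross_sandwich:
  assumes "unitary l" "unitary m"
  shows "cross l m (l * x * m) = m * cross m l x * l"
  by (simp add: cross_def algebra_simps unitaryD[OF assms(1)] unitaryD[OF assms(2)])

lemma alt_cross_sandwich:
  assumes "unitary l" "unitary m"
  shows "alt_cross l m n (l * x * m)
    = (if even n then l * alt_cross m l n x * m else m * alt_cross m l n x * l)"
  using assms
  by (induction n arbitrary: l m x) (simp_all add: cross_sandwich)

text \<open>The iterated commutator is recovered from the alternating composition by undoing the
  normalization. Solving for the iterate, and not for the composition, lets the induction run
  without adjoints of powers: \<open>c\<close> commutes with its powers, so the outer powers stay in place
  and one step takes place between them.\<close>
lemma commutator_iterate_eq_alt_cross:
  assumes "unitary l" "unitary m"
  defines "c \<equiv> l * m"
  shows "((\<lambda>y. c * y - y * c) ^^ n) x =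
    (if even n then c ^ (n div 2) * alt_cross l m n x * c ^ (n div 2)
     else c ^ (n div 2) * (l * alt_cross l m n x * m) * c ^ (n div 2))"
proof (induction n)
  case (Suc n)
  define A where "A = alt_cross l m n x"
  define k where "k = n div 2"
  note unit = unitaryD[OF assms(1)] unitaryD[OF assms(2)]
  have comm: "c * (c ^ k * y * c ^ k) - c ^ k * y * c ^ k * c = c ^ k * (c * y - y * c) * c ^ k"
    for y
  proof -
    have "c * (c ^ k * y * c ^ k) = c ^ k * (c * y) * c ^ k"
      by (metis mult.assoc power_commutes)
    moreover have "c ^ k * y * c ^ k * c = c ^ k * (y * c) * c ^ k"
      by (metis mult.assoc power_commutes)
    ultimately show ?thesis by (simp add: algebra_simps)
  qed
  show ?case
  proof (cases "even n")
    case True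
    have "c * A - A * c = l * cross l m A * m"
      by (simp add: cross_def c_def algebra_simps unit)
    then show ?thesis
      using True Suc comm[of A]
      by (simp add: alt_cross_Suc_outer del: alt_cross.simps(2) flip: A_def k_def)
  next
    case False
    have "c * (l * A * m) - l * A * m * c = c * cross m l A * c"
      by (simp add: cross_def c_def algebra_simps unit)
    moreover have "c ^ k * (c * y * c) * c ^ k = c ^ Suc k * y * c ^ Suc k" for y
      by (metis mult.assoc power_Suc power_Suc2)
    ultimately show ?thesis
      using False Suc comm[of "l * A * m"]
      by (simp add: alt_cross_Suc_outer del: power_Suc alt_cross.simps(2) flip: A_def k_def)
  qed
qed simp

lemma ad_shape_eq_alt_cross:
  assumes "unitary l" "unitary m"
  shows "ad_shape (entries (l * m)) (entries l) (entries m) n (entries x)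
    = entries (alt_cross l m n x)"
proof -
  define c where "c = l * m"
  define p where "p = badj c ^ (n div 2)"
  define X where "X = ((\<lambda>y. c * y - y * c) ^^ n) x"
  note X = commutator_iterate_eq_alt_cross[OF assms, of n x, folded c_def, folded X_def]
  note unit = unitaryD[OF assms(1)] unitaryD[OF assms(2)]
  have c: "c * badj c = 1" "badj c * c = 1"
    by (simp_all add: c_def badj_times mult.assoc unit)
  have p: "c ^ (n div 2) * p = 1" "p * c ^ (n div 2) = 1"
    unfolding p_def by (simp_all add: c left_right_inverse_power)
  have p': "p * (c ^ (n div 2) * y) = y" for y
    by (simp add: p flip: mult.assoc)
  have "ad_shape (entries c) (entries l) (entries m) n (entries x)
    = entries (if even n then p * X * p else badj l * p * X * p * badj m)"
    by (simp add: ad_shape_def Let_def p_def X_def entries_ad_iterate times_bandmat.rep_eq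
        entries_power badj.rep_eq)
  also have "(if even n then p * X * p else badj l * p * X * p * badj m) = alt_cross l m n x"
    unfolding X by (simp add: mult.assoc p p' unit)
  finally show ?thesis unfolding c_def .
qed

section \<open>The factors of a CMV matrix\<close>

lemma Theta_symmetric: "Theta \<alpha> n r s = Theta \<alpha> n s r"
  by (simp add: Theta_def)

text \<open>The diagonal entries use \<open>\<rho>\<^sup>2 = 1 - |\<alpha>|\<^sup>2\<close>, for which the square root must be of a
  nonnegative number; off the diagonal the two terms cancel because \<open>\<rho>\<close> is real.\<close>
lemma Theta_unitary:
  assumes "cmod (\<alpha> n) < 1" "r < 2" "s < 2"
  shows "(\<Sum>t<2. Theta \<alpha> n r t * cnj (Theta \<alpha> n s t)) = (if r = s then 1 else 0)"
proof -
  have "(cmod (\<alpha> n))\<^sup>2 \<le> 1" using assms(1) by (simp add: power_le_one)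
  then have "complex_of_real (rho \<alpha> n) * complex_of_real (rho \<alpha> n)
      = 1 - \<alpha> n * cnj (\<alpha> n)"
    by (simp add: rho_def complex_norm_square[unfolded of_real_power] flip: of_real_mult)
  then show ?thesis using assms(2,3)
    by (auto simp: Theta_def numeral_2_eq_2 less_Suc_eq mult.commute)
qed

lemma band_block_diag2: "band (block_diag2 B)"
  unfolding band_iff_bandwidth block_diag2_def by (intro exI[of _ 1]) (auto; presburger)

lemma band_one_oplus:
  assumes "band A"
  shows "band (one_oplus A)"
proof -
  obtain N where "\<And>i j. A i j \<noteq> 0 \<Longrightarrow> i \<le> j + N \<and> j \<le> i + N"
    using assms unfolding band_iff_bandwidth by blast
  then show ?thesis
    unfolding band_iff_bandwidth one_oplus_def
    by (intro exI[of _ N]) (auto split: nat.splits)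
qed

lemma mtrans_block_diag2:
  assumes "\<And>p r s. B p r s = B p s r"
  shows "mtrans (block_diag2 B) = block_diag2 B"
  using assms by (auto intro!: ext simp: mtrans_def block_diag2_def)

lemma mtrans_one_oplus: "mtrans (one_oplus A) = one_oplus (mtrans A)"
  by (auto intro!: ext simp: mtrans_def one_oplus_def split: nat.splits)

lemma madj_one_oplus: "madj (one_oplus A) = one_oplus (madj A)"
  by (auto intro!: ext simp: madj_def one_oplus_def split: nat.splits)

lemma block_diag2_mmult_madj:
  assumes "\<And>p r s. r < 2 \<Longrightarrow> s < 2 \<Longrightarrow>
    (\<Sum>t<2. B p r t * cnj (B p s t)) = (if r = s then 1 else 0)"
  shows "block_diag2 B \<star> madj (block_diag2 B) = mone"
proof (intro ext)
  fix i j :: nat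
  define p where "p = i div 2"
  have "(block_diag2 B \<star> madj (block_diag2 B)) i j
      = (\<Sum>k\<in>{2 * p, 2 * p + 1}. block_diag2 B i k * madj (block_diag2 B) k j)"
    by (rule mmult_eq_sum) (auto simp: block_diag2_def p_def; presburger)+
  also have "\<dots> = (if j div 2 = p then \<Sum>t<2. B p (i mod 2) t * cnj (B p (j mod 2) t) else 0)"
    by (auto simp: block_diag2_def madj_def lessThan_nat_numeral p_def[symmetric])
  also have "\<dots> = (if j div 2 = p then if i mod 2 = j mod 2 then 1 else 0 else 0)"
    using assms by simp
  also have "\<dots> = mone i j"
    unfolding mone_def p_def by (metis div_mult_mod_eq)
  finally show "(block_diag2 B \<star> madj (block_diag2 B)) i j = mone i j" .
qed

lemma one_oplus_mmult:
  assumes "band A"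
  shows "one_oplus A \<star> one_oplus B = one_oplus (A \<star> B)"
proof (intro ext)
  fix i j :: nat
  show "(one_oplus A \<star> one_oplus B) i j = one_oplus (A \<star> B) i j"
  proof (cases i)
    case 0
    then have "(one_oplus A \<star> one_oplus B) i j
        = (\<Sum>k\<in>{0}. one_oplus A i k * one_oplus B k j)"
      by (intro mmult_eq_sum) (auto simp: one_oplus_def split: nat.splits)
    then show ?thesis using 0 by (simp add: one_oplus_def split: nat.splits)
  next
    case (Suc i')
    obtain N where N: "\<And>k. A i' k \<noteq> 0 \<Longrightarrow> k \<le> i' + N"
      using assms unfolding band_iff_bandwidth by meson
    have "(one_oplus A \<star> one_oplus B) i j
        = (\<Sum>k<Suc (Suc (i' + N)). one_oplus A i k * one_oplus B k j)"
      by (rule mmult_eq_sum_lessThan)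
        (use N in \<open>fastforce simp: one_oplus_def Suc split: nat.splits\<close>)
    also have "\<dots> = (\<Sum>k<Suc (i' + N). A i' k * one_oplus B (Suc k) j)"
      by (subst sum.lessThan_Suc_shift) (simp add: one_oplus_def Suc)
    also have "\<dots> = one_oplus (A \<star> B) i j"
    proof (cases j)
      case (Suc j')
      have "(A \<star> B) i' j' = (\<Sum>k<Suc (i' + N). A i' k * B k j')"
        by (rule mmult_eq_sum_lessThan) (use N in fastforce)
      then show ?thesis using \<open>i = Suc i'\<close> Suc by (simp add: one_oplus_def)
    qed (simp add: one_oplus_def Suc)
    finally show ?thesis .
  qed
qed

lemma one_oplus_mone: "one_oplus mone = mone"
  by (auto intro!: ext simp: one_oplus_def mone_def split: nat.splits)

lemma band_Lfac: "band (Lfac \<alpha>)"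
  by (simp add: Lfac_def band_block_diag2)

lemma band_Mfac: "band (Mfac \<alpha>)"
  by (simp add: Mfac_def band_block_diag2 band_one_oplus)

lemma mtrans_Lfac: "mtrans (Lfac \<alpha>) = Lfac \<alpha>"
  unfolding Lfac_def by (rule mtrans_block_diag2) (rule Theta_symmetric)

lemma mtrans_Mfac: "mtrans (Mfac \<alpha>) = Mfac \<alpha>"
  unfolding Mfac_def mtrans_one_oplus
  by (subst mtrans_block_diag2) (auto intro: Theta_symmetric)

lemma Lfac_mmult_madj:
  assumes "\<And>j. cmod (\<alpha> j) < 1"
  shows "Lfac \<alpha> \<star> madj (Lfac \<alpha>) = mone"
  unfolding Lfac_def by (intro block_diag2_mmult_madj Theta_unitary assms)

lemma Mfac_mmult_madj:
  assumes "\<And>j. cmod (\<alpha> j) < 1"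
  shows "Mfac \<alpha> \<star> madj (Mfac \<alpha>) = mone"
proof -
  have "block_diag2 (\<lambda>p. Theta \<alpha> (2 * p + 1)) \<star> madj (block_diag2 (\<lambda>p. Theta \<alpha> (2 * p + 1)))
      = mone"
    by (intro block_diag2_mmult_madj Theta_unitary assms)
  then show ?thesis
    by (simp add: Mfac_def madj_one_oplus one_oplus_mmult band_block_diag2 one_oplus_mone)
qed

text \<open>An infinite matrix may have a one-sided inverse only; for a symmetric matrix the second
  identity is the transpose of the first.\<close>
lemma unitary_if_symmetric:
  assumes "btrans u = u" "u * badj u = 1"
  shows "unitary u"
proof -
  have "badj u * u = btrans (u * badj u)"
    by (simp add: btrans_times btrans_badj assms(1))
  then show ?thesis using assms(2) by (simp add: unitary_def)
qed

theorem proposition5p1: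
  fixes \<alpha> :: "nat \<Rightarrow> complex" and \<Omega> :: inf_mat and n :: nat
  assumes "\<And>j. cmod (\<alpha> j) < 1"
    and "band \<Omega>"
  shows "mtrans (ad_C \<alpha> n \<Omega>) = mscale ((-1) ^ n) (ad_Ct \<alpha> n (mtrans \<Omega>))
    \<and> (even n \<longrightarrow> ad_C \<alpha> n (Lfac \<alpha> \<star> \<Omega> \<star> Mfac \<alpha>) = Lfac \<alpha> \<star> ad_Ct \<alpha> n \<Omega> \<star> Mfac \<alpha>)
    \<and> (odd n \<longrightarrow> ad_C \<alpha> n (Lfac \<alpha> \<star> \<Omega> \<star> Mfac \<alpha>) = Mfac \<alpha> \<star> ad_Ct \<alpha> n \<Omega> \<star> Lfac \<alpha>)
    \<and> (\<forall>k\<le>n. ad_C \<alpha> n \<Omega> = (if even k then ad_C \<alpha> else ad_Ct \<alpha>) (n - k) (ad_C \<alpha> k \<Omega>))"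
proof -
  obtain x where x: "\<Omega> = entries x"
    using assms(2) by (metis Bandmat_inverse mem_Collect_eq)
  obtain l where l: "Lfac \<alpha> = entries l"
    using band_Lfac by (metis Bandmat_inverse mem_Collect_eq)
  obtain m where m: "Mfac \<alpha> = entries m"
    using band_Mfac by (metis Bandmat_inverse mem_Collect_eq)
  have sym: "btrans l = l" "btrans m = m"
    using mtrans_Lfac[of \<alpha>] mtrans_Mfac[of \<alpha>] unfolding l m
    by (simp_all add: btrans.rep_eq flip: entries_inject)
  have "l * badj l = 1" "m * badj m = 1"
    using Lfac_mmult_madj[of \<alpha>, OF assms(1)] Mfac_mmult_madj[of \<alpha>, OF assms(1)] unfolding l m
    by (simp_all add: times_bandmat.rep_eq badj.rep_eq one_bandmat.rep_eq flip: entries_inject)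
  then have unit: "unitary l" "unitary m"
    using sym by (simp_all add: unitary_if_symmetric)
  have "cmv \<alpha> = entries (l * m)"
    by (simp add: cmv_def l m times_bandmat.rep_eq)
  moreover have "mtrans (entries (l * m)) = entries (m * l)"
    by (simp add: btrans_times sym flip: btrans.rep_eq)
  ultimately have ad: "ad_C \<alpha> j (entries y) = entries (alt_cross l m j y)"
      "ad_Ct \<alpha> j (entries y) = entries (alt_cross m l j y)" for j y
    by (simp_all add: ad_C_def ad_Ct_def l m ad_shape_eq_alt_cross unit)
  have "ad_C \<alpha> n \<Omega> = (if even k then ad_C \<alpha> else ad_Ct \<alpha>) (n - k) (ad_C \<alpha> k \<Omega>)"
    if "k \<le> n" for k
    using that alt_cross_add[of l m k "n - k" x] by (simp add: x ad)
  then show ?thesis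
    using alt_cross_sandwich[OF unit, of n x] btrans_alt_cross[OF sym, of n x]
    by (simp add: x l m ad mscale_sign_entries flip: times_bandmat.rep_eq btrans.rep_eq)
qed

end
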